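(* Let $G$ be a minimally $1$-tough graph of order $n$ and girth $g \ge 5$. Then $G$ has a vertex of degree at most $\left\lfloor \frac{n}{g+1} \right\rfloor + g - 1$.
   Context: All graphs are finite, simple and undirected. The order $n$ of a graph is its number of vertices; the girth $g$ is the length of a shortest cycle. For a graph $G$ and $S\subseteq V(G)$, $w(G-S)$ denotes the number of connected components of $G-S$. The toughness of a noncomplete graph $G$ is $\tau(G)=\min\left\{\frac{|S|}{w(G-S)} : S\subseteq V(G),\ w(G-S)\ge 2\right\}$, and $\tau(G)=+\infty$ if $G$ is complete. A graph $G$ is minimally $t$-tough if $\tau(G)=t$ and $\tau(G-e)<t$ for every edge $e\in E(G)$, where $G-e$ is $G$ with the edge $e$ deleted. *)

theory Defs
  imports
    "Graph_Theory.Graph_Theory"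
    "HOL-Library.Extended_Nat"
    "HOL-Library.Extended_Real"
begin

text \<open>
  A finite simple undirected graph is a \<^verbatim>\<open>pair_graph\<close>: a finite vertex set \<^verbatim>\<open>pverts G\<close>
  with a symmetric, irreflexive adjacency relation \<^verbatim>\<open>parcs G\<close>. An undirected edge $uv$ is
  thus the pair of arcs $(u,v)$, $(v,u)$, and the degree of a vertex is its \<^verbatim>\<open>out_degree\<close>.
\<close>

definition components :: "'a pair_pre_digraph \<Rightarrow> ('a, 'a \<times> 'a) pre_digraph set" where
  "components G = {C. pre_digraph.max_subgraph (with_proj G) Digraph_Component.connected C}"

definition delete_verts :: "'a pair_pre_digraph \<Rightarrow> 'a set \<Rightarrow> 'a pair_pre_digraph" where
  "delete_verts G S =
     \<lparr> pverts = pverts G - S,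
       parcs = {(u, v) \<in> parcs G. u \<notin> S \<and> v \<notin> S} \<rparr>"

definition delete_edge :: "'a pair_pre_digraph \<Rightarrow> 'a \<Rightarrow> 'a \<Rightarrow> 'a pair_pre_digraph" where
  "delete_edge G u v = \<lparr> pverts = pverts G, parcs = parcs G - {(u, v), (v, u)} \<rparr>"

definition complete_graph :: "'a pair_pre_digraph \<Rightarrow> bool" where
  "complete_graph G \<longleftrightarrow> complete_digraph (card (pverts G)) (with_proj G)"

definition toughness :: "'a pair_pre_digraph \<Rightarrow> ereal" where
  "toughness G =
     (if complete_graph G then \<infinity>
      else Min {ereal (real (card S) / real (card (components (delete_verts G S)))) | S.
                  S \<subseteq> pverts G \<and> card (components (delete_verts G S)) \<ge> 2})"

definition minimally_tough :: "real \<Rightarrow> 'a pair_pre_digraph \<Rightarrow> bool" where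
  "minimally_tough t G \<longleftrightarrow>
     toughness G = ereal t \<and>
     (\<forall>(u, v) \<in> parcs G. toughness (delete_edge G u v) < ereal t)"

text \<open>
  The library's \<^verbatim>\<open>cycle\<close> is directed and so admits the closed walk $a,b,a$ along a single edge;
  the undirected cycles are those of length at least 3. The girth of a forest is \<open>\<infinity>\<close>.
\<close>

definition girth :: "'a pair_pre_digraph \<Rightarrow> enat" where
  "girth G = (INF p \<in> {p. pre_digraph.cycle (with_proj G) p \<and> length p \<ge> 3}. enat (length p))"

end

theory Submission
  imports Defs
begin

text \<open>
  Girth at least 5 already forces the bound. Without 4-cycles, the neighbourhoods of the
  neighbours of a vertex $v$, with $v$ removed, are pairwise disjoint, so minimum degree at
  least $d$ forces $n \ge d(d - 1)$. For $d = q + g$ with $q = \lfloor n/(g+1) \rfloor$ this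
  exceeds $(g + 1)(q + 1) > n$.
\<close>

text \<open>Trades arcs for end vertices, so that neighbourhoods can be united and counted as vertex
  sets.\<close>

lemma out_degree_eq_card_Image:
  "out_degree (with_proj G) v = card (parcs G `` {v})"
proof -
  have "out_arcs (with_proj G) v = Pair v ` (parcs G `` {v})"
    by (auto simp: out_arcs_def)
  then show ?thesis
    by (simp add: out_degree_def card_image inj_on_def)
qed

lemma girth_le_cycle_length:
  assumes "pre_digraph.cycle (with_proj G) p" "length p \<ge> 3"
  shows "girth G \<le> enat (length p)"
  unfolding girth_def using assms by (intro INF_lower) auto

text \<open>An infimum over no cycles would be \<open>\<infinity>\<close>, so some cycle exists, and
  its starting vertex is a vertex at which the count can begin.\<close>

lemma girth_eq_enatE:
  assumes "girth G = enat g"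
  obtains v where "v \<in> pverts G"
proof -
  have "{p. pre_digraph.cycle (with_proj G) p \<and> length p \<ge> 3} \<noteq> {}"
    using assms unfolding girth_def by (metis INF_empty enat.distinct(1) top_enat_def)
  then show thesis
    using that by (auto simp: pre_digraph.cycle_def pre_digraph.awalk_def)
qed

context pair_graph
begin

text \<open>Two distinct such neighbours would close the 4-cycle v, a, x, b.\<close>

lemma common_neighbour_unique:
  assumes girth: "girth G \<ge> 5"
    and "(v, a) \<in> parcs G" "(v, b) \<in> parcs G" "(a, x) \<in> parcs G" "(b, x) \<in> parcs G" "x \<noteq> v"
  shows "a = b"
proof (rule ccontr)
  assume "a \<noteq> b"
  let ?p = "[(v, a), (a, x), (x, b), (b, v)]"
  have arcs: "(x, b) \<in> parcs G" "(b, v) \<in> parcs G"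
    using assms arcs_symmetric by auto
  have "a \<noteq> x" "a \<noteq> v" "b \<noteq> x" "b \<noteq> v"
    using assms pair_no_loops by fastforce+
  then have "cycle ?p"
    using assms arcs \<open>a \<noteq> b\<close> in_arcsD1
    by (auto simp: cycle_def awalk_def)
  then have "girth G \<le> 4"
    using girth_le_cycle_length[of G ?p] by (simp add: numeral_eq_enat eval_nat_numeral)
  with girth have "(5::enat) \<le> 4"
    by (rule order_trans)
  then show False
    by simp
qed

lemma card_verts_ge_min_degree:
  assumes girth: "girth G \<ge> 5"
    and "v \<in> pverts G"
    and deg: "\<And>w. w \<in> pverts G \<Longrightarrow> d \<le> out_degree (with_proj G) w"
  shows "d * (d - 1) \<le> card (pverts G)"
proof -
  let ?N = "\<lambda>w. parcs G `` {w}"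
  have sub: "?N w \<subseteq> pverts G" for w
    using in_arcsD2 by auto
  have fin: "finite (?N w)" for w
    using sub pair_finite_verts by (rule finite_subset)
  have N: "d \<le> card (?N w)" if "w \<in> pverts G" for w
    using deg[OF that] by (simp add: out_degree_eq_card_Image)
  have "d * (d - 1) \<le> (\<Sum>w\<in>?N v. d - 1)"
    using N[OF \<open>v \<in> pverts G\<close>] by simp
  also have "\<dots> \<le> (\<Sum>w\<in>?N v. card (?N w - {v}))"
  proof (rule sum_mono)
    fix w assume "w \<in> ?N v"
    then have "d \<le> card (?N w)"
      using N sub by blast
    \<comment> \<open>Removing v costs at most one element.\<close>
    then show "d - 1 \<le> card (?N w - {v})"
      using fin[of w] by (auto simp: card_Diff_singleton_if)
  qed
  also have "\<dots> = card (\<Union>w\<in>?N v. ?N w - {v})"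
  proof (rule card_UN_disjoint[symmetric])
    \<comment> \<open>A shared element would be a vertex other than v adjacent to both a and b,
      which forces a = b.\<close>
    show "\<forall>a\<in>?N v. \<forall>b\<in>?N v. a \<noteq> b \<longrightarrow> (?N a - {v}) \<inter> (?N b - {v}) = {}"
      using common_neighbour_unique[OF girth] by blast
  qed (use fin in auto)
  also have "\<dots> \<le> card (pverts G)"
    using sub by (intro card_mono pair_finite_verts) blast
  finally show ?thesis .
qed

end

lemma less_div_add_mult:
  fixes n g :: nat
  assumes "g \<ge> 3"
  shows "n < (n div (g + 1) + g) * (n div (g + 1) + g - 1)"
proof -
  define q where "q = n div (g + 1)"
  \<comment> \<open>This substitution removes the truncated subtraction. The difference of the two
    products below becomes q^2 + (k + 1) q + k^2 + 4 k + 2, whose coefficients are all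
    positive.\<close>
  obtain k where g: "g = k + 3"
    using assms by (metis add.commute le_Suc_ex)
  have "n < (g + 1) * (q + 1)"
    unfolding q_def using dividend_less_div_times[of "g + 1" n] by (simp add: algebra_simps)
  also have "\<dots> \<le> (q + g) * (q + g - 1)"
    unfolding g by (simp add: algebra_simps)
  finally show ?thesis
    by (simp only: q_def)
qed

theorem theorem1p6:
  fixes G :: "'a pair_pre_digraph" and n g :: nat
  assumes "pair_graph G"
    and "minimally_tough 1 G"
    and "card (pverts G) = n"
    and "girth G = enat g"
    and "g \<ge> 5"
  shows "\<exists>v \<in> pverts G. out_degree (with_proj G) v \<le> n div (g + 1) + g - 1"
proof (rule ccontr)
  interpret pair_graph G
    by fact
  let ?d = "n div (g + 1) + g"
  assume "\<not> ?thesis"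
  \<comment> \<open>For natural numbers, exceeding \<open>?d - 1\<close> means being at least
    \<open>?d\<close>.\<close>
  then have deg: "?d \<le> out_degree (with_proj G) w" if "w \<in> pverts G" for w
    using that by fastforce
  obtain v where "v \<in> pverts G"
    using girth_eq_enatE \<open>girth G = enat g\<close> .
  moreover have "girth G \<ge> 5"
    using \<open>girth G = enat g\<close> \<open>g \<ge> 5\<close> by (simp add: numeral_eq_enat)
  ultimately have "?d * (?d - 1) \<le> n"
    using card_verts_ge_min_degree[of v ?d] deg \<open>card (pverts G) = n\<close> by blast
  with less_div_add_mult[of g n] \<open>g \<ge> 5\<close> show False
    by simp
qed

end
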